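(* Let $n\ge1$. Let $\mathsf B(n)=(\mathsf b_{j+k})_{0\le j,k<n}$ be the Hankel matrix of middle binomial coefficients and $\mathsf R(n)=(\mathsf b_{j,k})_{0\le j,k<n}$ the lower-triangular matrix of semi-binomial numbers. For $0\le j,k<n$, $$\bigl(\mathsf R(n)^{-1}\bigr)_{j,k}=(-1)^{j+k}\left[2\binom{j+k}{j-k}-\binom{j+k-1}{j-k}\right],$$ $$\bigl(\mathsf B(n)^{-1}\bigr)_{j,k}=\frac{\delta_{j0}\delta_{k0}}{2}+\frac{(-1)^{j+k}}{2}\sum_{i=\max\{j,k\}}^{n-1}\left[2\binom{i+j}{i-j}-\binom{i+j-1}{i-j}\right]\left[2\binom{i+k}{i-k}-\binom{i+k-1}{i-k}\right].$$
   Context: $\mathsf b_p=\binom{2p}{p}$. The semi-Catalan numbers are $\mathsf c_{p,q}=\binom{2p}{p+q}-\binom{2p}{p+q+1}$ (so $\mathsf c_{p,q}=0$ for $q>p\ge 0$), and the semi-binomial numbers are $\mathsf b_{p,q}=\mathsf c_{p,q}+\mathsf c_{p,q+1}+\dots+\mathsf c_{p,p}$ for $0\le q\le p$, and $\mathsf b_{p,q}=0$ for $q>p$. Conventions: $\binom{p}{q}=0$ if $q<0$, and $\binom{-1}{0}=1$. $\delta_{ab}$ is the Kronecker delta. *)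

theory Defs
  imports "Jordan_Normal_Form.Gauss_Jordan_Elimination"
begin

definition middle_binomial :: "nat \<Rightarrow> nat" where
  "middle_binomial p = (2 * p) choose p"

definition semi_catalan :: "nat \<Rightarrow> nat \<Rightarrow> int" where
  "semi_catalan p q = int ((2 * p) choose (p + q)) - int ((2 * p) choose (p + q + 1))"

text \<open>For \<open>q > p\<close> the range of summation is empty, so the value is 0.\<close>

definition semi_binomial :: "nat \<Rightarrow> nat \<Rightarrow> int" where
  "semi_binomial p q = (\<Sum>i = q..p. semi_catalan p i)"

text \<open>
  Binomial coefficient with integer arguments: zero for a negative lower argument; for a
  negative upper argument it is the generalized binomial coefficient, so that
  \<open>int_binomial (- 1) 0 = 1\<close>.
\<close>

definition int_binomial :: "int \<Rightarrow> int \<Rightarrow> rat" where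
  "int_binomial p q = (if q < 0 then 0 else of_int p gchoose nat q)"

definition hankel_mat :: "nat \<Rightarrow> rat mat" where
  "hankel_mat n = mat n n (\<lambda>(j, k). of_nat (middle_binomial (j + k)))"

definition semi_binomial_mat :: "nat \<Rightarrow> rat mat" where
  "semi_binomial_mat n = mat n n (\<lambda>(j, k). of_int (semi_binomial j k))"

end

theory Submission
  imports Defs "Jordan_Normal_Form.Determinant"
begin

text \<open>
  Put \<open>u = x + 2 + 1 / x\<close>. The coefficient of \<open>x ^ k\<close> in the Laurent polynomial
  \<open>u ^ p = (1 + x) ^ (2 * p) / x ^ p\<close> is \<open>2 * p choose (p + k)\<close>. Since semi-binomial numbers
  telescope to these coefficients, \<open>R(n)\<close> expands the powers of \<open>u\<close> in the basis \<open>L 0 = 1\<close>,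
  \<open>L j = x ^ j + 1 / x ^ j\<close> (\<open>j > 0\<close>) of the symmetric Laurent polynomials, and its inverse
  \<open>A\<close> expands the \<open>L j\<close> in powers of \<open>u\<close>. That the claimed
  numbers do this follows from the Chebyshev-like recurrence \<open>L (j + 1) = (u - 2) * L j - L (j - 1)\<close>
  (for \<open>j > 1\<close>; for \<open>j = 1\<close> the last term is doubled), which they inherit from Pascal's rule.

  The key lemma \<open>chebyshev_sum\<close> compares coefficients in
  \<open>u ^ p * L j = (\<Sum>i. A j i * u ^ (i + p))\<close>. For \<open>p = 0\<close> it says that \<open>A\<close> inverts \<open>R(n)\<close>. Its
  constant term (\<open>k = 0\<close>) says that \<open>A * B(n) = D * R(n)\<^sup>T\<close>, where \<open>D\<close> is the diagonal matrix
  with entries \<open>1, 2, 2, \<dots>\<close>. Hence \<open>A\<^sup>T * D\<^sup>-\<^sup>1 * A * B(n) = (R(n) * A)\<^sup>T = 1\<close>, and the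
  entries of \<open>A\<^sup>T * D\<^sup>-\<^sup>1 * A\<close> are the claimed ones.
\<close>

section \<open>Coefficients of the powers of \<open>u\<close>\<close>

text \<open>The convention for negative lower arguments makes Pascal's rule hold for all integers, which
  spares all case distinctions at the border of the triangle.\<close>

lemma int_binomial_pascal:
  "int_binomial (p + 1) (q + 1) = int_binomial p q + int_binomial p (q + 1)"
proof (cases "q < 0")
  case True
  then show ?thesis by (cases "q = -1") (auto simp: int_binomial_def)
next
  case False
  then have "nat (q + 1) = Suc (nat q)" by simp
  then show ?thesis
    using False by (simp add: int_binomial_def gbinomial_Suc_Suc)
qed

lemma int_binomial_of_nat: "int_binomial (int p) (int q) = of_nat (p choose q)"
  by (simp add: int_binomial_def binomial_gbinomial)

text \<open>The coefficient of \<open>x ^ k\<close> in \<open>u ^ p\<close>.\<close>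

definition central_coeff :: "nat \<Rightarrow> int \<Rightarrow> rat" where
  "central_coeff p k = int_binomial (2 * int p) (int p + k)"

lemma central_coeff_0: "central_coeff 0 k = (if k = 0 then 1 else 0)"
proof (cases "k > 0")
  case True
  then obtain m where "k = int m" "m > 0" by (metis zero_less_imp_eq_int)
  then show ?thesis
    using int_binomial_of_nat[of 0 m] by (simp add: central_coeff_def)
qed (auto simp: central_coeff_def int_binomial_def)

text \<open>Coefficientwise, this is multiplication by \<open>u = x + 2 + 1 / x\<close>.\<close>

lemma central_coeff_Suc:
  "central_coeff (Suc p) k
     = central_coeff p (k - 1) + 2 * central_coeff p k + central_coeff p (k + 1)"
  using int_binomial_pascal[of "2 * int p + 1" "int p + k"]
    int_binomial_pascal[of "2 * int p" "int p + k - 1"]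
    int_binomial_pascal[of "2 * int p" "int p + k"]
  by (simp add: central_coeff_def algebra_simps)

lemma central_coeff_nat: "central_coeff p (int k) = of_nat ((2 * p) choose (p + k))"
  using int_binomial_of_nat[of "2 * p" "p + k"] by (simp add: central_coeff_def)

lemma central_coeff_minus: "central_coeff p (- k) = central_coeff p k"
proof (induction p arbitrary: k)
  case (Suc p)
  have "central_coeff p (- k - 1) = central_coeff p (k + 1)"
    using Suc[of "k + 1"] by simp
  moreover have "central_coeff p (- k + 1) = central_coeff p (k - 1)"
    using Suc[of "k - 1"] by simp
  ultimately show ?case by (simp add: central_coeff_Suc Suc)
qed (simp add: central_coeff_0)

lemma semi_binomial_eq_central_coeff: "of_int (semi_binomial p q) = central_coeff p (int q)"
proof -
  have "semi_binomial p q = int ((2 * p) choose (p + q))"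
  proof (cases "q \<le> p")
    case True
    define f where "f i = - int ((2 * p) choose (p + i))" for i
    have "semi_binomial p q = (\<Sum>i = q..p. f (Suc i) - f i)"
      by (simp add: semi_binomial_def semi_catalan_def f_def)
    also have "\<dots> = f (Suc p) - f q"
      using True by (simp add: sum_Suc_diff)
    finally show ?thesis by (simp add: f_def)
  qed (simp add: semi_binomial_def)
  then show ?thesis by (simp add: central_coeff_nat)
qed

lemma middle_binomial_eq_central_coeff: "of_nat (middle_binomial p) = central_coeff p 0"
  using central_coeff_nat[of p 0] by (simp add: middle_binomial_def)

section \<open>The \<open>L j\<close> as polynomials in \<open>u\<close>\<close>

text \<open>Up to the sign \<open>(-1) ^ (j + k)\<close>, this is the coefficient of \<open>u ^ k\<close> in \<open>L j\<close>.\<close>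

definition chebyshev_coeff :: "int \<Rightarrow> int \<Rightarrow> rat" where
  "chebyshev_coeff j k = 2 * int_binomial (j + k) (j - k) - int_binomial (j + k - 1) (j - k)"

text \<open>Both binomials in the definition satisfy this recurrence separately: for each, it is Pascal's
  rule applied three times.\<close>

lemma chebyshev_coeff_rec:
  "chebyshev_coeff (j + 1) k
     = chebyshev_coeff j (k - 1) + 2 * chebyshev_coeff j k - chebyshev_coeff (j - 1) k"
proof -
  have *: "int_binomial (p + 1) (q + 1)
      = int_binomial (p - 1) (q + 1) + 2 * int_binomial p q - int_binomial (p - 1) (q - 1)" for p q
    using int_binomial_pascal[of p q] int_binomial_pascal[of "p - 1" q]
      int_binomial_pascal[of "p - 1" "q - 1"] by simp
  show ?thesis
    using *[of "j + k" "j - k"] *[of "j + k - 1" "j - k"]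
    by (simp add: chebyshev_coeff_def algebra_simps)
qed

lemma chebyshev_coeff_eq_0: "j < k \<Longrightarrow> chebyshev_coeff j k = 0"
  by (simp add: chebyshev_coeff_def int_binomial_def)

text \<open>The value \<open>-1\<close>, due to \<open>int_binomial (- 1) 2 = 1\<close>, accounts for the doubled last
  term in \<open>L 2 = (u - 2) * L 1 - 2 * L 0\<close>.\<close>

lemma chebyshev_coeff_minus_one:
  "chebyshev_coeff (1 + int j) (- 1) = (if j = 0 then - 1 else 0)"
proof (cases j)
  case 0
  have "int_binomial (- 1) 2 = 1"
    by (simp add: int_binomial_def gbinomial_minus eval_nat_numeral gbinomial_Suc)
  moreover have "int_binomial 0 2 = 0"
    using int_binomial_of_nat[of 0 2] by simp
  ultimately show ?thesis
    using 0 by (simp add: chebyshev_coeff_def)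
next
  case (Suc i)
  have "int_binomial (1 + int i) (3 + int i) = 0"
    using int_binomial_of_nat[of "1 + i" "3 + i"] by simp
  moreover have "int_binomial (int i) (3 + int i) = 0"
    using int_binomial_of_nat[of i "3 + i"] by simp
  ultimately show ?thesis
    using Suc by (simp add: chebyshev_coeff_def algebra_simps)
qed

lemma chebyshev_coeff_00: "chebyshev_coeff 0 0 = 1"
  by (simp add: chebyshev_coeff_def int_binomial_def)

lemma chebyshev_coeff_10: "chebyshev_coeff 1 0 = 2"
  using int_binomial_of_nat[of 1 1] int_binomial_of_nat[of 0 1]
  by (simp add: chebyshev_coeff_def)

lemma chebyshev_coeff_11: "chebyshev_coeff 1 1 = 1"
  by (simp add: chebyshev_coeff_def int_binomial_def)

text \<open>The coefficient of \<open>x ^ k\<close> in \<open>u ^ p * L j\<close>, computed in two ways. The bound \<open>m\<close> is left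
  free so that the induction hypotheses for \<open>j\<close> and \<open>j + 1\<close> apply to sums over the same range.\<close>

lemma chebyshev_sum:
  assumes "j \<le> m"
  shows "(\<Sum>i\<le>m. (- 1) ^ i * chebyshev_coeff (int j) (int i) * central_coeff (i + p) k)
    = (- 1) ^ j * (if j = 0 then central_coeff p k
        else central_coeff p (k - int j) + central_coeff p (k + int j))"
  using assms
proof (induction j arbitrary: m k rule: induct_nat_012)
  case 0
  have "(\<Sum>i\<le>m. (- 1) ^ i * chebyshev_coeff 0 (int i) * central_coeff (i + p) k)
      = (\<Sum>i\<in>{0}. (- 1) ^ i * chebyshev_coeff 0 (int i) * central_coeff (i + p) k)"
    by (rule sum.mono_neutral_right) (auto simp: chebyshev_coeff_eq_0)
  then show ?case by (simp add: chebyshev_coeff_00)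
next
  case 1
  have "(\<Sum>i\<le>m. (- 1) ^ i * chebyshev_coeff 1 (int i) * central_coeff (i + p) k)
      = (\<Sum>i\<in>{0, 1}. (- 1) ^ i * chebyshev_coeff 1 (int i) * central_coeff (i + p) k)"
    using 1 by (intro sum.mono_neutral_right) (auto simp: chebyshev_coeff_eq_0)
  then show ?case
    by (simp add: chebyshev_coeff_10 chebyshev_coeff_11 central_coeff_Suc)
next
  case (ge2 j)
  define S where "S j m k =
    (\<Sum>i\<le>m. (- 1) ^ i * chebyshev_coeff j (int i) * central_coeff (i + p) k)" for j m k
  obtain m' where m: "m = Suc m'" and m': "Suc j \<le> m'"
    using ge2.prems by (cases m) auto
  have rec: "chebyshev_coeff (int j + 2) (int i) = chebyshev_coeff (int j + 1) (int i - 1)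
      + 2 * chebyshev_coeff (int j + 1) (int i) - chebyshev_coeff (int j) (int i)" for i
    using chebyshev_coeff_rec[of "int j + 1" "int i"] by (simp add: add.commute)
  have split: "S (int j + 2) m k
      = (\<Sum>i\<le>m. (- 1) ^ i * chebyshev_coeff (int j + 1) (int i - 1) * central_coeff (i + p) k)
        + 2 * S (int j + 1) m k - S (int j) m k"
    unfolding S_def rec sum_distrib_left sum.distrib[symmetric] sum_subtractf[symmetric]
    by (intro sum.cong) (auto simp: algebra_simps)
  \<comment> \<open>Multiplication by \<open>u\<close> shifts the exponent \<open>i\<close>; the term with exponent \<open>-1\<close> is present only
    for \<open>j = 0\<close>.\<close>
  have shift: "(\<Sum>i\<le>m. (- 1) ^ i * chebyshev_coeff (int j + 1) (int i - 1) * central_coeff (i + p) k)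
      = chebyshev_coeff (int j + 1) (- 1) * central_coeff p k
        - (S (int j + 1) m' (k - 1) + 2 * S (int j + 1) m' k + S (int j + 1) m' (k + 1))"
  proof -
    have "(\<Sum>i\<le>m'. (- 1) ^ Suc i * chebyshev_coeff (int j + 1) (int (Suc i) - 1)
          * central_coeff (Suc i + p) k)
        = - (S (int j + 1) m' (k - 1) + 2 * S (int j + 1) m' k + S (int j + 1) m' (k + 1))"
      unfolding S_def sum_distrib_left sum.distrib[symmetric] sum_negf[symmetric]
      by (intro sum.cong) (auto simp: central_coeff_Suc algebra_simps)
    then show ?thesis
      unfolding m sum.atMost_Suc_shift by simp
  qed
  have IH0: "S (int j) m k = (- 1) ^ j * (if j = 0 then central_coeff p k
      else central_coeff p (k - int j) + central_coeff p (k + int j))"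
    using ge2.IH(1)[of m k] ge2.prems by (simp add: S_def)
  have IH1: "S (int j + 1) l k = (- 1) ^ Suc j *
      (central_coeff p (k - int j - 1) + central_coeff p (k + int j + 1))" if "Suc j \<le> l" for l k
    using ge2.IH(2)[of l k] that by (simp add: S_def algebra_simps)
  have "S (int j + 1) m k = S (int j + 1) m' k"
    using m m' IH1[of m k] IH1[of m' k] by simp
  then have "S (int j + 2) m k = (if j = 0 then - central_coeff p k else 0)
      - S (int j + 1) m' (k - 1) - S (int j + 1) m' (k + 1) - S (int j) m k"
    using split shift chebyshev_coeff_minus_one[of j] by (simp add: add.commute)
  then have "S (int j + 2) m k
      = (- 1) ^ j * (central_coeff p (k - (int j + 2)) + central_coeff p (k + (int j + 2)))"
    unfolding IH0 IH1[OF m'] by (cases "j = 0") (simp_all add: algebra_simps)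
  then show ?case by (simp add: S_def algebra_simps)
qed

section \<open>The inverse matrices\<close>

definition chebyshev_mat :: "nat \<Rightarrow> rat mat" where
  "chebyshev_mat n = mat n n (\<lambda>(j, k). (- 1) ^ (j + k) * chebyshev_coeff (int j) (int k))"

lemma chebyshev_mat_mult_entry:
  assumes "j < n"
  shows "(\<Sum>i<n. ((- 1) ^ (j + i) * chebyshev_coeff (int j) (int i)) * central_coeff (i + p) k)
    = (if j = 0 then central_coeff p k
        else central_coeff p (k - int j) + central_coeff p (k + int j))"
proof -
  have "{..<n} = {..n - 1}" using assms by auto
  then have "(\<Sum>i<n. ((- 1) ^ (j + i) * chebyshev_coeff (int j) (int i)) * central_coeff (i + p) k)
    = (- 1) ^ j *
      (\<Sum>i\<le>n - 1. (- 1) ^ i * chebyshev_coeff (int j) (int i) * central_coeff (i + p) k)"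
    by (simp add: sum_distrib_left power_add mult.assoc)
  also have "\<dots> = (if j = 0 then central_coeff p k
        else central_coeff p (k - int j) + central_coeff p (k + int j))"
    using assms by (subst chebyshev_sum) (auto simp: mult.assoc[symmetric] power_add[symmetric])
  finally show ?thesis .
qed

lemma chebyshev_mat_mult_semi_binomial_mat: "chebyshev_mat n * semi_binomial_mat n = 1\<^sub>m n"
proof (rule eq_matI)
  fix j k assume "j < dim_row (1\<^sub>m n :: rat mat)" "k < dim_col (1\<^sub>m n :: rat mat)"
  then have jk: "j < n" "k < n" by auto
  then show "(chebyshev_mat n * semi_binomial_mat n) $$ (j, k) = 1\<^sub>m n $$ (j, k)"
    using chebyshev_mat_mult_entry[of j n 0 "int k"]
    by (auto simp: chebyshev_mat_def semi_binomial_mat_def scalar_prod_def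
        semi_binomial_eq_central_coeff central_coeff_0 atLeast0LessThan)
qed (auto simp: chebyshev_mat_def semi_binomial_mat_def)

lemma semi_binomial_mat_mult_chebyshev_mat: "semi_binomial_mat n * chebyshev_mat n = 1\<^sub>m n"
  by (rule mat_mult_left_right_inverse[OF _ _ chebyshev_mat_mult_semi_binomial_mat])
    (auto simp: chebyshev_mat_def semi_binomial_mat_def)

text \<open>This is \<open>A * B(n) = D * R(n)\<^sup>T\<close>: a constant term picks both \<open>x ^ j\<close> and
  \<open>1 / x ^ j\<close> out of \<open>L j\<close>, and \<open>u\<close> is symmetric.\<close>

lemma chebyshev_mat_mult_hankel_mat:
  "chebyshev_mat n * hankel_mat n
     = mat n n (\<lambda>(j, k). (if j = 0 then 1 else 2) * semi_binomial_mat n $$ (k, j))"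
proof (rule eq_matI, goal_cases)
  case (1 j k)
  then have "j < n" "k < n" by auto
  then show ?case
    using chebyshev_mat_mult_entry[of j n k 0] central_coeff_minus[of k "int j"]
    by (simp add: chebyshev_mat_def semi_binomial_mat_def hankel_mat_def scalar_prod_def
        semi_binomial_eq_central_coeff middle_binomial_eq_central_coeff atLeast0LessThan)
qed (auto simp: chebyshev_mat_def hankel_mat_def)

text \<open>The matrix \<open>D\<^sup>-\<^sup>1 * A\<close>.\<close>

definition halved_chebyshev_mat :: "nat \<Rightarrow> rat mat" where
  "halved_chebyshev_mat n =
     mat n n (\<lambda>(i, k). (if i = 0 then 1 else 1 / 2) * chebyshev_mat n $$ (i, k))"

lemma inverse_mult_hankel_mat:
  "(halved_chebyshev_mat n)\<^sup>T * chebyshev_mat n * hankel_mat n = 1\<^sub>m n"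
proof -
  have "(halved_chebyshev_mat n)\<^sup>T * chebyshev_mat n * hankel_mat n
      = (halved_chebyshev_mat n)\<^sup>T * (chebyshev_mat n * hankel_mat n)"
    by (rule assoc_mult_mat)
      (auto simp: halved_chebyshev_mat_def chebyshev_mat_def hankel_mat_def)
  also have "\<dots> = (semi_binomial_mat n * chebyshev_mat n)\<^sup>T"
    unfolding chebyshev_mat_mult_hankel_mat
    by (rule eq_matI)
      (auto simp: halved_chebyshev_mat_def chebyshev_mat_def semi_binomial_mat_def
        scalar_prod_def intro!: sum.cong)
  finally show ?thesis by (simp add: semi_binomial_mat_mult_chebyshev_mat)
qed

text \<open>The \<open>i\<close>-th summand of the matrix product carries the sign
  \<open>(-1) ^ (i + j) * (-1) ^ (i + k) = (-1) ^ (j + k)\<close> and vanishes for \<open>i < max j k\<close>. The Kronecker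
  term makes up for weighting the summand \<open>i = 0\<close>, which is nonzero only for \<open>j = k = 0\<close>, with
  \<open>1 / 2\<close> instead of \<open>1\<close>.\<close>

lemma inverse_hankel_mat_entry:
  assumes "j < n" "k < n"
  shows "((halved_chebyshev_mat n)\<^sup>T * chebyshev_mat n) $$ (j, k)
    = (if j = 0 then 1 else 0) * (if k = 0 then 1 else 0) / 2
      + (- 1) ^ (j + k) / 2 *
        (\<Sum>i = max j k..n - 1.
          chebyshev_coeff (int i) (int j) * chebyshev_coeff (int i) (int k))"
proof -
  define f where "f i = chebyshev_coeff (int i) (int j) * chebyshev_coeff (int i) (int k)" for i
  have sign: "(- 1) ^ (i + j) * (- 1) ^ (i + k) = ((- 1) ^ (j + k) :: rat)" for i
    by (simp add: power_add)
  have f0: "f 0 = (if j = 0 then 1 else 0) * (if k = 0 then 1 else 0)"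
    by (simp add: f_def chebyshev_coeff_00 chebyshev_coeff_eq_0)
  have "((halved_chebyshev_mat n)\<^sup>T * chebyshev_mat n) $$ (j, k)
      = (\<Sum>i<n. (if i = 0 then 1 else 1 / 2) * ((- 1) ^ (i + j) * (- 1) ^ (i + k)) * f i)"
    using assms
    by (auto simp: halved_chebyshev_mat_def chebyshev_mat_def scalar_prod_def f_def
        atLeast0LessThan mult_ac intro!: sum.cong)
  also have "\<dots> = (\<Sum>i<n. (if i = 0 then (- 1) ^ (j + k) / 2 * f 0 else 0)
      + (- 1) ^ (j + k) / 2 * f i)"
    unfolding sign by (intro sum.cong) auto
  also have "\<dots> = (- 1) ^ (j + k) / 2 * f 0 + (- 1) ^ (j + k) / 2 * (\<Sum>i<n. f i)"
    using assms by (simp add: sum.distrib sum_distrib_left)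
  also have "(\<Sum>i<n. f i) = (\<Sum>i = max j k..n - 1. f i)"
    using assms by (intro sum.mono_neutral_right) (auto simp: f_def chebyshev_coeff_eq_0)
  finally show ?thesis unfolding f0 by (simp add: f_def)
qed

lemma mat_inverse_eqI:
  fixes M N :: "'a::field mat"
  assumes M: "M \<in> carrier_mat n n" and N: "N \<in> carrier_mat n n" and NM: "N * M = 1\<^sub>m n"
  shows "mat_inverse M = Some N"
proof -
  have MN: "M * N = 1\<^sub>m n"
    by (rule mat_mult_left_right_inverse[OF N M NM])
  show ?thesis
  proof (cases "mat_inverse M")
    case None
    then have "M \<notin> Units (ring_mat TYPE('a) n undefined)"
      by (rule mat_inverse(1)[OF M])
    moreover have "M \<in> Units (ring_mat TYPE('a) n undefined)"
      using M N MN NM unfolding Units_def by (auto simp: ring_mat_def)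
    ultimately show ?thesis by contradiction
  next
    case (Some C)
    from mat_inverse(2)[OF M Some] have C: "M * C = 1\<^sub>m n" "C \<in> carrier_mat n n" by auto
    have "N = N * (M * C)" using N C by simp
    also have "\<dots> = N * M * C" using M N C by simp
    finally show ?thesis using NM C Some by simp
  qed
qed

theorem proposition7p5:
  fixes n :: nat
  assumes "n \<ge> 1"
  shows "mat_inverse (semi_binomial_mat n) = Some (mat n n (\<lambda>(j, k).
           (- 1) ^ (j + k) *
             (2 * int_binomial (int j + int k) (int j - int k)
               - int_binomial (int j + int k - 1) (int j - int k))))
       \<and> mat_inverse (hankel_mat n) = Some (mat n n (\<lambda>(j, k).
           (if j = 0 then 1 else 0) * (if k = 0 then 1 else 0) / 2
           + (- 1) ^ (j + k) / 2 *
             (\<Sum>i = max j k..n - 1.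
               (2 * int_binomial (int i + int j) (int i - int j)
                 - int_binomial (int i + int j - 1) (int i - int j)) *
               (2 * int_binomial (int i + int k) (int i - int k)
                 - int_binomial (int i + int k - 1) (int i - int k)))))"
proof
  have "mat_inverse (semi_binomial_mat n) = Some (chebyshev_mat n)"
    by (rule mat_inverse_eqI[OF _ _ chebyshev_mat_mult_semi_binomial_mat])
      (auto simp: chebyshev_mat_def semi_binomial_mat_def)
  from this[unfolded chebyshev_mat_def chebyshev_coeff_def]
  show "mat_inverse (semi_binomial_mat n) = Some (mat n n (\<lambda>(j, k).
           (- 1) ^ (j + k) *
             (2 * int_binomial (int j + int k) (int j - int k)
               - int_binomial (int j + int k - 1) (int j - int k))))" .
next
  have "mat_inverse (hankel_mat n) = Some ((halved_chebyshev_mat n)\<^sup>T * chebyshev_mat n)"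
    by (rule mat_inverse_eqI[OF _ _ inverse_mult_hankel_mat])
      (auto simp: halved_chebyshev_mat_def chebyshev_mat_def hankel_mat_def)
  also have "(halved_chebyshev_mat n)\<^sup>T * chebyshev_mat n = mat n n (\<lambda>(j, k).
           (if j = 0 then 1 else 0) * (if k = 0 then 1 else 0) / 2
           + (- 1) ^ (j + k) / 2 *
             (\<Sum>i = max j k..n - 1.
               chebyshev_coeff (int i) (int j) * chebyshev_coeff (int i) (int k)))"
  proof (rule eq_matI, goal_cases)
    case (1 j k)
    then show ?case by (simp add: inverse_hankel_mat_entry del: index_mult_mat(1))
  qed (auto simp: halved_chebyshev_mat_def chebyshev_mat_def)
  finally show "mat_inverse (hankel_mat n) = Some (mat n n (\<lambda>(j, k).
           (if j = 0 then 1 else 0) * (if k = 0 then 1 else 0) / 2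
           + (- 1) ^ (j + k) / 2 *
             (\<Sum>i = max j k..n - 1.
               (2 * int_binomial (int i + int j) (int i - int j)
                 - int_binomial (int i + int j - 1) (int i - int j)) *
               (2 * int_binomial (int i + int k) (int i - int k)
                 - int_binomial (int i + int k - 1) (int i - int k)))))"
    unfolding chebyshev_coeff_def .
qed

end
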